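(* Let $\mu\ge 1$, $0\le\gamma<1$, $-1\le B<A\le 1$, $-1\le B<0$, and let $k\ge m$ be non-negative integers. Let $\Phi_\mu(z)=z+\sum_{n=2}^\infty\vartheta_n z^{\mu n}$ and $\Psi_\mu(z)=z+\sum_{n=2}^\infty\lambda_n z^{\mu n}$ be convergent in $\mathbb U$ with $\vartheta_n\ge 0$, $\lambda_n\ge 0$, $\vartheta_n\ge\lambda_n$ for all $n\ge 2$. For $n\ge2$ put $$\Xi(n)=(1-B)\big((\mu n)^k\vartheta_n-(\mu n)^m\lambda_n\big)+(A-B)(1-\gamma)(\mu n)^m\lambda_n .$$ Let $F_\mu(z)=z-\sum_{n=2}^\infty a_nz^{\mu n}$ ($a_n\ge0$) be in $\widetilde{\mathcal E}_{k,m}(\Phi_\mu,\Psi_\mu,A,B,\mu,\gamma)$ and let $0\le\psi<1$. Then: (i) $F_\mu$ is starlike of order $\psi$ in $|z|<r_1$, where $$r_1=\inf_{n\ge2}\left\{\frac{\Xi(n)}{(A-B)(1-\gamma)}\cdot\frac{1-\psi}{\mu n-\psi}\right\}^{1/(\mu n-1)}.$$ (ii) $F_\mu$ is convex of order $\psi$ in $|z|<r_2$, where $$r_2=\inf_{n\ge2}\left\{\frac{\Xi(n)}{(A-B)(1-\gamma)}\cdot\frac{1-\psi}{\mu n(\mu n-\psi)}\right\}^{1/(\mu n-1)}.$$ (iii) $F_\mu$ is close-to-convex (of bounded turning) of order $\psi$ in $|z|<r_3$, where $$r_3=\inf_{n\ge2}\left\{\frac{\Xi(n)}{(A-B)(1-\gamma)}\cdot\frac{1-\psi}{\mu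 n}\right\}^{1/(\mu n-1)}.$$ Each of these results is sharp, with extremal functions $F_n(z)=z-\frac{(A-B)(1-\gamma)}{\Xi(n)}z^{\mu n}$ ($n\ge2$): if $\Xi(n)>0$ for all $n\ge 2$, then for each of the three properties, with corresponding radius $r_j$, and each $\rho$ with $r_j<\rho\le 1$, there is $n\ge2$ such that $F_n\in\widetilde{\mathcal E}_{k,m}(\Phi_\mu,\Psi_\mu,A,B,\mu,\gamma)$ does not have that property in $|z|<\rho$.
   Context: $\mathbb U=\{z\in\mathbb C:|z|<1\}$. For real $\mu\ge1$, powers $z^{s}$ with $s>0$ are taken with the principal branch for $z\ne0$, and equal $0$ at $z=0$. $\mathcal A_\mu$ is the class of functions $F_\mu(z)=z+\sum_{n=2}^\infty a_nz^{\mu n}$ ($a_n\in\mathbb C$) whose series converges in $\mathbb U$; $\mathcal X_\mu$ is the subclass of functions of the form $F_\mu(z)=z-\sum_{n=2}^\infty a_nz^{\mu n}$ with all $a_n\ge0$. Derivatives are taken termwise: for $F_\mu\in\mathcal X_\mu$, $F_\mu'(z)=1-\sum_{n\ge2}\mu n\,a_nz^{\mu n-1}$ and $zF_\mu''(z)=-\sum_{n\ge2}\mu n(\mu n-1)a_nz^{\mu n-1}$. For $F_\mu(z)=z+\sum_{n\ge2}a_nz^{\mu n}$ and $G_\mu(z)=z+\sum_{n\ge2}b_nz^{\mu n}$ the convolution is $(F_\mu*G_\mu)(z)=z+\sum_{n\ge2}a_nb_nz^{\mu n}$. For a non-negative integer $\beta$ the operator $D_\mu^\beta$ is $D_\mu^\beta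 F_\mu(z)=z+\sum_{n=2}^\infty(\mu n)^\beta a_nz^{\mu n}$. A function $F_\mu\in\mathcal A_\mu$ belongs to $\mathcal E_{k,m}(\Phi_\mu,\Psi_\mu,A,B,\mu,\gamma)$ if, for all $z$ with $0<|z|<1$, $(F_\mu*\Psi_\mu)(z)\neq0$, $D_\mu^m(F_\mu*\Psi_\mu)(z)\ne0$, and the quotient $q(z)=\dfrac{D_\mu^k(F_\mu*\Phi_\mu)(z)}{D_\mu^m(F_\mu*\Psi_\mu)(z)}$ satisfies $$\left|\frac{q(z)-1}{(A-B)(1-\gamma)-B\,(q(z)-1)}\right|<1,$$ with the denominator non-zero. (This is the inequality form of the subordination $q(z)\prec(1-\gamma)\frac{1+Az}{1+Bz}+\gamma$.) Finally $\widetilde{\mathcal E}_{k,m}(\Phi_\mu,\Psi_\mu,A,B,\mu,\gamma)=\mathcal E_{k,m}(\Phi_\mu,\Psi_\mu,A,B,\mu,\gamma)\cap\mathcal X_\mu$. For $r>0$ and $0\le\psi<1$, $F_\mu$ is, in $|z|<r$: starlike of order $\psi$ if $\Re\{zF_\mu'(z)/F_\mu(z)\}>\psi$; convex of order $\psi$ if $\Re\{1+zF_\mu''(z)/F_\mu'(z)\}>\psi$; close-to-convex (of bounded turning) of order $\psi$ if $\Re F_\mu'(z)>\psi$; in each case for all $z\in\mathbb U$ with $0<|z|<r$, the denominators being non-zero. (For $r=0$ the assertion is vacuous; for $r>1$ it concerns only $z\in\mathbb U$.) *)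

theory Defs
  imports "HOL-Analysis.Analysis"
begin

text \<open>
  A series \<open>z + (\<Sum>n\<ge>2. c n * z^(\<mu> n))\<close> is represented by its coefficient sequence
  \<open>c :: nat \<Rightarrow> complex\<close>; the entries \<open>c 0\<close> and \<open>c 1\<close> are never used.  Convolution,
  the multiplier operator and the termwise derivatives act on coefficients, and
  function classes are sets of coefficient sequences.  Complex \<open>powr\<close> is the
  principal branch, with \<open>0 powr s = 0\<close>.
\<close>

definition mu_series :: "real \<Rightarrow> (nat \<Rightarrow> complex) \<Rightarrow> complex \<Rightarrow> complex" where
  "mu_series \<mu> c z = z + (\<Sum>n. c (n + 2) * z powr of_real (\<mu> * real (n + 2)))"

definition mu_deriv :: "real \<Rightarrow> (nat \<Rightarrow> complex) \<Rightarrow> complex \<Rightarrow> complex" where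
  "mu_deriv \<mu> c z =
     1 + (\<Sum>n. of_real (\<mu> * real (n + 2)) * c (n + 2) * z powr of_real (\<mu> * real (n + 2) - 1))"

text \<open>The product \<open>z F''(z)\<close>, as a series in its own right.\<close>

definition mu_z_deriv2 :: "real \<Rightarrow> (nat \<Rightarrow> complex) \<Rightarrow> complex \<Rightarrow> complex" where
  "mu_z_deriv2 \<mu> c z =
     (\<Sum>n. of_real (\<mu> * real (n + 2) * (\<mu> * real (n + 2) - 1)) * c (n + 2)
            * z powr of_real (\<mu> * real (n + 2) - 1))"

definition class_A :: "real \<Rightarrow> (nat \<Rightarrow> complex) set" where
  "class_A \<mu> =
     {c. \<forall>z. norm z < 1 \<longrightarrow> summable (\<lambda>n. c (n + 2) * z powr of_real (\<mu> * real (n + 2)))}"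

definition class_X :: "real \<Rightarrow> (nat \<Rightarrow> complex) set" where
  "class_X \<mu> = {c \<in> class_A \<mu>. \<exists>a :: nat \<Rightarrow> real. \<forall>n\<ge>2. a n \<ge> 0 \<and> c n = - of_real (a n)}"

definition mu_conv :: "(nat \<Rightarrow> complex) \<Rightarrow> (nat \<Rightarrow> complex) \<Rightarrow> nat \<Rightarrow> complex" where
  "mu_conv c d n = c n * d n"

definition mu_D :: "real \<Rightarrow> nat \<Rightarrow> (nat \<Rightarrow> complex) \<Rightarrow> nat \<Rightarrow> complex" where
  "mu_D \<mu> \<beta> c n = of_real ((\<mu> * real n) ^ \<beta>) * c n"

definition class_E ::
  "nat \<Rightarrow> nat \<Rightarrow> (nat \<Rightarrow> complex) \<Rightarrow> (nat \<Rightarrow> complex) \<Rightarrow> real \<Rightarrow> real \<Rightarrow> real \<Rightarrow> real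
    \<Rightarrow> (nat \<Rightarrow> complex) set" where
  "class_E k m \<Phi> \<Psi> A B \<mu> \<gamma> =
     {c \<in> class_A \<mu>. \<forall>z. 0 < norm z \<and> norm z < 1 \<longrightarrow>
        mu_series \<mu> (mu_conv c \<Psi>) z \<noteq> 0 \<and>
        mu_series \<mu> (mu_D \<mu> m (mu_conv c \<Psi>)) z \<noteq> 0 \<and>
        (let q = mu_series \<mu> (mu_D \<mu> k (mu_conv c \<Phi>)) z
                   / mu_series \<mu> (mu_D \<mu> m (mu_conv c \<Psi>)) z;
             d = of_real ((A - B) * (1 - \<gamma>)) - of_real B * (q - 1)
         in d \<noteq> 0 \<and> norm ((q - 1) / d) < 1)}"

definition class_E_tilde ::
  "nat \<Rightarrow> nat \<Rightarrow> (nat \<Rightarrow> complex) \<Rightarrow> (nat \<Rightarrow> complex) \<Rightarrow> real \<Rightarrow> real \<Rightarrow> real \<Rightarrow> real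
    \<Rightarrow> (nat \<Rightarrow> complex) set" where
  "class_E_tilde k m \<Phi> \<Psi> A B \<mu> \<gamma> = class_E k m \<Phi> \<Psi> A B \<mu> \<gamma> \<inter> class_X \<mu>"

definition starlike_of_order :: "real \<Rightarrow> (nat \<Rightarrow> complex) \<Rightarrow> real \<Rightarrow> real \<Rightarrow> bool" where
  "starlike_of_order \<mu> c \<psi> r \<longleftrightarrow>
     (\<forall>z. 0 < norm z \<and> norm z < r \<and> norm z < 1 \<longrightarrow>
        mu_series \<mu> c z \<noteq> 0 \<and> Re (z * mu_deriv \<mu> c z / mu_series \<mu> c z) > \<psi>)"

definition convex_of_order :: "real \<Rightarrow> (nat \<Rightarrow> complex) \<Rightarrow> real \<Rightarrow> real \<Rightarrow> bool" where
  "convex_of_order \<mu> c \<psi> r \<longleftrightarrow>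
     (\<forall>z. 0 < norm z \<and> norm z < r \<and> norm z < 1 \<longrightarrow>
        mu_deriv \<mu> c z \<noteq> 0 \<and> Re (1 + mu_z_deriv2 \<mu> c z / mu_deriv \<mu> c z) > \<psi>)"

definition close_to_convex_of_order :: "real \<Rightarrow> (nat \<Rightarrow> complex) \<Rightarrow> real \<Rightarrow> real \<Rightarrow> bool" where
  "close_to_convex_of_order \<mu> c \<psi> r \<longleftrightarrow>
     (\<forall>z. 0 < norm z \<and> norm z < r \<and> norm z < 1 \<longrightarrow> Re (mu_deriv \<mu> c z) > \<psi>)"

end

theory Submission
  imports Defs
begin

text \<open>
  Throughout write \<open>C = (A - B) (1 - \<gamma>) > 0\<close>.  The theorem compares two linear conditions on
  the coefficients \<open>a n \<ge> 0\<close> of \<open>F z = z - (\<Sum>n\<ge>2. a n * z^(\<mu> n))\<close>.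

  \<^emph>\<open>Membership bounds the coefficients\<close> (\<open>class_E_tilde_coeff_bound\<close>): \<open>(\<Sum>n. \<Xi> n * a n) \<le> C\<close>.
  On the positive real axis all series are real.  There the denominator of \<open>q\<close>, divided by
  \<open>z\<close>, is continuous, tends to \<open>1\<close> at \<open>0\<close> and never vanishes, hence stays
  positive.  So \<open>1 - q\<close> is real and nonnegative, and the inequality defining the class becomes
  \<open>(\<Sum>n. \<Xi> n * a n * s^(\<mu> n - 1)) < C\<close>.  Letting \<open>s\<close> tend to \<open>1\<close> gives the bound.

  \<^emph>\<open>The three properties follow from weighted coefficient bounds.\<close>  In \<open>|z| = s\<close> the triangle
  inequality shows that \<open>F\<close> is starlike of order \<open>\<psi>\<close> if
  \<open>(\<Sum>n. (\<mu> n - \<psi>) * a n * s^(\<mu> n - 1)) < 1 - \<psi>\<close> (\<open>starlike_if_weighted_sum\<close>), and of bounded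
  turning of order \<open>\<psi>\<close> if the same holds with weight \<open>\<mu> n\<close>.  Convexity of \<open>F\<close> is starlikeness of
  \<open>z F'\<close> (Alexander's relation, \<open>convex_iff_starlike\<close>), which gives the weight
  \<open>\<mu> n (\<mu> n - \<psi>)\<close>.

  The radius attached to a weight is exactly what makes the \<open>n\<close>-th weighted term at most
  \<open>(1 - \<psi>) * \<Xi> n * a n / C\<close> for every \<open>n\<close> (\<open>weighted_sum_lt_inside_radius\<close>), so the first bound
  implies the second.

  \<^emph>\<open>Sharpness.\<close>  The function \<open>z - (C / \<Xi> n) z^(\<mu> n)\<close> attains equality in the coefficient bound and
  lies in the class.  At the real point \<open>t\<close> whose value is the \<open>n\<close>-th
  element in the infimum, the quantity whose real part should exceed \<open>\<psi>\<close> equals \<open>\<psi>\<close>.  If \<open>\<rho>\<close> is larger than the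
  infimum, some such \<open>t\<close> lies below \<open>\<rho>\<close>.
\<close>

section \<open>Convergence in the unit disc\<close>

text \<open>
  For \<open>z \<noteq> 0\<close> the series \<open>(\<Sum>n\<ge>2. c n * z^(\<mu> n))\<close> has the same absolute values as a power series in
  \<open>|z|^\<mu>\<close>; convergence in the unit disc therefore means radius of convergence at least \<open>1\<close>.
  By Abel's lemma this says that \<open>c n * x^n\<close> is bounded for every \<open>x < 1\<close>, a condition that the
  termwise products and polynomial weights of convolution, \<open>mu_D\<close> and differentiation preserve:
  split \<open>x\<close> as \<open>sqrt x * sqrt x\<close> and give one factor to each sequence.
\<close>

lemma conv_radius_ge_1I:
  fixes c :: "nat \<Rightarrow> 'a :: {banach, real_normed_div_algebra}"
  assumes "\<And>x. 0 < x \<Longrightarrow> x < 1 \<Longrightarrow> \<exists>K. \<forall>n. norm (c n) * x ^ n \<le> K"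
  shows "1 \<le> conv_radius c"
proof (rule conv_radius_geI_ex')
  fix r :: real assume r: "0 < r" "ereal r < 1"
  \<comment> \<open>A bound at \<open>sqrt r\<close> leaves a geometric factor \<open>sqrt r ^ n\<close> to sum.\<close>
  let ?x = "sqrt r"
  have x: "0 < ?x" "?x < 1" "?x * ?x = r" using r by (auto simp: one_ereal_def)
  from assms[OF x(1,2)] obtain K where K: "\<And>n. norm (c n) * ?x ^ n \<le> K" by blast
  show "summable (\<lambda>n. c n * of_real r ^ n)"
  proof (rule summable_comparison_test')
    show "summable (\<lambda>n. K * ?x ^ n)" using x by (intro summable_mult summable_geometric) simp
    fix n
    have "norm (c n * of_real r ^ n) = norm (c n) * ?x ^ n * ?x ^ n"
      using r x(3) by (simp add: norm_mult norm_power flip: power_mult_distrib)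
    also have "\<dots> \<le> K * ?x ^ n" using K x by (intro mult_right_mono) auto
    finally show "norm (c n * of_real r ^ n) \<le> K * ?x ^ n" .
  qed
qed

lemma conv_radius_ge_1D:
  fixes c :: "nat \<Rightarrow> 'a :: {banach, real_normed_div_algebra}"
  assumes "1 \<le> conv_radius c" "0 < x" "x < 1"
  shows "\<exists>K. \<forall>n. norm (c n) * x ^ n \<le> K"
proof -
  have "ereal (norm (of_real x :: 'a)) < conv_radius c"
    using assms by (intro less_le_trans[OF _ assms(1)]) (simp add: one_ereal_def)
  from abs_summable_in_conv_radius[OF this]
  have "summable (\<lambda>n. norm (c n) * x ^ n)" using assms by (simp add: norm_mult norm_power)
  then have "Bseq (\<lambda>n. norm (c n) * x ^ n)"
    by (intro convergent_imp_Bseq) (auto simp: convergent_def dest: summable_LIMSEQ_zero)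
  then obtain K where "\<And>n. norm (norm (c n) * x ^ n) \<le> K" by (auto simp: Bseq_def)
  then show ?thesis by (intro exI[of _ K]) (auto intro: order_trans[OF abs_ge_self])
qed

lemma conv_radius_ge_1_mult:
  fixes c d :: "nat \<Rightarrow> 'a :: {banach, real_normed_div_algebra}"
  assumes "1 \<le> conv_radius c" "1 \<le> conv_radius d"
  shows "1 \<le> conv_radius (\<lambda>n. c n * d n)"
proof (rule conv_radius_ge_1I)
  fix x :: real assume "0 < x" "x < 1"
  then have x: "0 < sqrt x" "sqrt x < 1" "sqrt x * sqrt x = x" by auto
  obtain K where K: "\<And>n. norm (c n) * sqrt x ^ n \<le> K"
    using conv_radius_ge_1D[OF assms(1) x(1,2)] by blast
  obtain L where L: "\<And>n. norm (d n) * sqrt x ^ n \<le> L"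
    using conv_radius_ge_1D[OF assms(2) x(1,2)] by blast
  have "norm (c n * d n) * x ^ n \<le> K * L" for n
  proof -
    have "x ^ n = sqrt x ^ n * sqrt x ^ n" by (simp only: x(3) flip: power_mult_distrib)
    then have "norm (c n * d n) * x ^ n = (norm (c n) * sqrt x ^ n) * (norm (d n) * sqrt x ^ n)"
      by (simp only: norm_mult mult_ac)
    also have "\<dots> \<le> K * L"
      using K L x by (intro mult_mono order_trans[OF _ K[of n]]) auto
    finally show ?thesis .
  qed
  then show "\<exists>K. \<forall>n. norm (c n * d n) * x ^ n \<le> K" by blast
qed

lemma conv_radius_ge_1_bounded:
  fixes c :: "nat \<Rightarrow> 'a :: {banach, real_normed_div_algebra}"
  assumes "\<And>n. norm (c n) \<le> K"
  shows "1 \<le> conv_radius c"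
proof (rule conv_radius_ge_1I)
  fix x :: real assume x: "0 < x" "x < 1"
  have "norm (c n) * x ^ n \<le> K * 1" for n
    using x assms order_trans[OF norm_ge_zero assms] by (intro mult_mono power_le_one) auto
  then show "\<exists>K. \<forall>n. norm (c n) * x ^ n \<le> K" by blast
qed

lemma conv_radius_ge_1_of_nat: "1 \<le> conv_radius (\<lambda>n. real n)"
proof (rule conv_radius_ge_1I)
  fix x :: real assume "0 < x" "x < 1"
  then have "(\<lambda>n. of_nat n * x ^ n) \<longlonglongrightarrow> 0" by (intro powser_times_n_limit_0) simp
  then have "Bseq (\<lambda>n. real n * x ^ n)" by (intro convergent_imp_Bseq) (auto simp: convergent_def)
  then obtain K where "\<And>n. norm (real n * x ^ n) \<le> K" by (auto simp: Bseq_def)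
  then show "\<exists>K. \<forall>n. norm (real n) * x ^ n \<le> K"
    by (intro exI[of _ K]) (auto intro: order_trans[OF abs_ge_self])
qed

lemma conv_radius_ge_1_lincomb:
  fixes b d :: "nat \<Rightarrow> real"
  assumes "1 \<le> conv_radius b" "1 \<le> conv_radius d"
  shows "1 \<le> conv_radius (\<lambda>n. u * b n + v * d n)"
proof -
  have const: "1 \<le> conv_radius (\<lambda>n. u)" for u :: real
    by (rule conv_radius_ge_1_bounded[where K = "\<bar>u\<bar>"]) simp
  have "1 \<le> min (conv_radius (\<lambda>n. u * b n)) (conv_radius (\<lambda>n. v * d n))"
    using conv_radius_ge_1_mult[OF const assms(1)] conv_radius_ge_1_mult[OF const assms(2)] by simp
  then show ?thesis using conv_radius_add_ge order_trans by blast
qed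

lemma conv_radius_ge_1_linear_weight: "1 \<le> conv_radius (\<lambda>n. p * real n + q)"
  using conv_radius_ge_1_lincomb[OF conv_radius_ge_1_of_nat
      conv_radius_ge_1_bounded[of "\<lambda>n. 1" 1], of p q] by simp

lemma conv_radius_ge_1_power_weight: "1 \<le> conv_radius (\<lambda>n. (\<mu> * real n) ^ j)"
proof (induction j)
  case 0
  show ?case by (rule conv_radius_ge_1_bounded[where K = 1]) simp
next
  case (Suc j)
  then show ?case
    using conv_radius_ge_1_mult[OF conv_radius_ge_1_linear_weight[of \<mu> 0] Suc] by simp
qed

lemma conv_radius_of_real:
  "conv_radius (\<lambda>n. of_real (b n) :: 'a :: {banach, real_normed_div_algebra}) = conv_radius b"
proof -
  have "conv_radius (\<lambda>n. of_real (b n) :: 'a) = conv_radius (\<lambda>n. norm (of_real (b n) :: 'a))"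
    by (rule conv_radius_norm[symmetric])
  also have "\<dots> = conv_radius (\<lambda>n. norm (b n))" by simp
  finally show ?thesis by (simp only: conv_radius_norm)
qed

lemma powr_mu_eq_power:
  assumes "0 < s"
  shows "s powr (\<mu> * real n) = (s powr \<mu>) ^ n"
  using assms by (simp add: powr_powr flip: powr_realpow)

lemma mu_index_ge_2:
  fixes \<mu> :: real
  assumes "1 \<le> \<mu>" "2 \<le> n"
  shows "2 \<le> \<mu> * real n"
  using assms mult_mono[of 1 \<mu> 2 "real n"] by simp

lemma summable_mu_terms:
  fixes c :: "nat \<Rightarrow> 'a :: {banach, real_normed_div_algebra}"
  assumes "1 \<le> conv_radius c" "0 < \<mu>" "0 < s" "s < 1"
  shows "summable (\<lambda>n. norm (c (n + 2)) * s powr (\<mu> * real (n + 2)))"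
proof -
  have x: "0 < s powr \<mu>" "s powr \<mu> < 1" using assms powr_less_mono2[of \<mu> s 1] by auto
  have "ereal (norm (of_real (s powr \<mu>) :: 'a)) < conv_radius c"
    using x by (intro less_le_trans[OF _ assms(1)]) (simp add: one_ereal_def)
  from abs_summable_in_conv_radius[OF this]
  have "summable (\<lambda>n. norm (c n) * (s powr \<mu>) ^ n)" using x by (simp add: norm_mult norm_power)
  then have "summable (\<lambda>n. norm (c (n + 2)) * (s powr \<mu>) ^ (n + 2))"
    by (subst summable_iff_shift[where f = "\<lambda>n. norm (c n) * (s powr \<mu>) ^ n"])
  then show ?thesis by (simp only: powr_mu_eq_power[OF assms(3)])
qed

lemma class_A_iff_conv_radius:
  assumes "1 \<le> \<mu>"
  shows "c \<in> class_A \<mu> \<longleftrightarrow> 1 \<le> conv_radius c"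
proof
  assume c: "c \<in> class_A \<mu>"
  show "1 \<le> conv_radius c"
  proof (rule conv_radius_geI_ex')
    fix r :: real assume r: "0 < r" "ereal r < 1"
    let ?s = "r powr (1 / \<mu>)"
    have s: "0 < ?s" "?s < 1" "?s powr \<mu> = r"
      using r assms powr_less_mono2[of "1 / \<mu>" r 1] by (auto simp: one_ereal_def powr_powr)
    have "complex_of_real ?s powr of_real (\<mu> * real n) = of_real r ^ n" for n
      using s powr_mu_eq_power[OF s(1)] by (subst powr_of_real) simp_all
    moreover have "norm (complex_of_real ?s) < 1" using s by simp
    then have "summable (\<lambda>n. c (n + 2) * of_real ?s powr of_real (\<mu> * real (n + 2)))"
      using c unfolding class_A_def by blast
    ultimately have "summable (\<lambda>n. c (n + 2) * of_real r ^ (n + 2))" by (simp only:)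
    then show "summable (\<lambda>n. c n * of_real r ^ n)"
      by (subst (asm) summable_iff_shift[where f = "\<lambda>n. c n * of_real r ^ n"])
  qed
next
  assume c: "1 \<le> conv_radius c"
  have "summable (\<lambda>n. c (n + 2) * z powr of_real (\<mu> * real (n + 2)))" if "norm z < 1" for z
  proof (cases "z = 0")
    case False
    have "summable (\<lambda>n. norm (c (n + 2) * z powr of_real (\<mu> * real (n + 2))))"
      using summable_mu_terms[OF c, of \<mu> "norm z"] False that assms
      by (simp add: norm_mult norm_powr_real_powr')
    then show ?thesis by (rule summable_norm_cancel)
  qed simp
  then show "c \<in> class_A \<mu>" by (simp add: class_A_def)
qed

section \<open>Series divided by z\<close>

text \<open>
  \<open>mu_tail\<close> is \<open>1 - F z / z\<close> for \<open>F z = z - (\<Sum>n\<ge>2. b n * z^(\<mu> n))\<close>, and \<open>mu_sum\<close> is its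
  restriction to the positive real axis, which also majorises it on circles when \<open>b \<ge> 0\<close>.  All the
  series in question are \<open>z (1 - mu_tail \<mu> b z)\<close> or \<open>1 - mu_tail \<mu> b z\<close> for suitable real \<open>b\<close>.
\<close>

definition mu_tail :: "real \<Rightarrow> (nat \<Rightarrow> real) \<Rightarrow> complex \<Rightarrow> complex" where
  "mu_tail \<mu> b z = (\<Sum>n. of_real (b (n + 2)) * z powr of_real (\<mu> * real (n + 2) - 1))"

definition mu_sum :: "real \<Rightarrow> (nat \<Rightarrow> real) \<Rightarrow> real \<Rightarrow> real" where
  "mu_sum \<mu> b s = (\<Sum>n. b (n + 2) * s powr (\<mu> * real (n + 2) - 1))"

lemma summable_mu_sum_abs:
  assumes "1 \<le> conv_radius b" "0 < \<mu>" "0 < s" "s < 1"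
  shows "summable (\<lambda>n. \<bar>b (n + 2)\<bar> * s powr (\<mu> * real (n + 2) - 1))"
  using summable_divide[OF summable_mu_terms[OF assms], of s] assms(3)
  by (simp add: powr_diff)

lemma summable_mu_sum:
  assumes "1 \<le> conv_radius b" "0 < \<mu>" "0 < s" "s < 1"
  shows "summable (\<lambda>n. b (n + 2) * s powr (\<mu> * real (n + 2) - 1))"
  by (rule summable_norm_cancel) (use summable_mu_sum_abs[OF assms] in \<open>simp add: abs_mult\<close>)

lemma summable_mu_tail:
  fixes z :: complex
  assumes "1 \<le> conv_radius b" "0 < \<mu>" "0 < norm z" "norm z < 1"
  shows "summable (\<lambda>n. of_real (b (n + 2)) * z powr of_real (\<mu> * real (n + 2) - 1))"
  by (rule summable_norm_cancel)
     (use summable_mu_sum_abs[OF assms] in \<open>simp add: norm_mult norm_powr_real_powr'\<close>)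

lemma norm_mu_tail_le:
  assumes "1 \<le> conv_radius b" "\<And>n. n \<ge> 2 \<Longrightarrow> 0 \<le> b n" "0 < \<mu>" "0 < norm z" "norm z < 1"
  shows "norm (mu_tail \<mu> b z) \<le> mu_sum \<mu> b (norm z)"
proof -
  have eq: "norm (of_real (b (n + 2)) * z powr of_real (\<mu> * real (n + 2) - 1))
      = b (n + 2) * norm z powr (\<mu> * real (n + 2) - 1)" for n
    using assms(2)[of "n + 2"] by (simp add: norm_mult norm_powr_real_powr')
  show ?thesis
    unfolding mu_tail_def mu_sum_def
    using summable_norm[of "\<lambda>n. of_real (b (n + 2)) * z powr of_real (\<mu> * real (n + 2) - 1)"]
      summable_mu_sum[OF assms(1,3-5)] unfolding eq by simp
qed

lemma mu_tail_of_real: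
  assumes "1 \<le> conv_radius b" "0 < \<mu>" "0 < s" "s < 1"
  shows "mu_tail \<mu> b (of_real s) = of_real (mu_sum \<mu> b s)"
proof -
  have "of_real (b (n + 2)) * complex_of_real s powr of_real (\<mu> * real (n + 2) - 1)
      = of_real (b (n + 2) * s powr (\<mu> * real (n + 2) - 1))" for n
    using assms by (subst powr_of_real) simp_all
  then show ?thesis
    unfolding mu_tail_def mu_sum_def by (simp only: suminf_of_real[OF summable_mu_sum[OF assms]])
qed

lemma mu_tail_add:
  assumes "1 \<le> conv_radius b" "1 \<le> conv_radius d" "0 < \<mu>" "0 < norm z" "norm z < 1"
  shows "mu_tail \<mu> (\<lambda>n. b n + d n) z = mu_tail \<mu> b z + mu_tail \<mu> d z"
  unfolding mu_tail_def
  using suminf_add[OF summable_mu_tail[OF assms(1,3-5)] summable_mu_tail[OF assms(2,3-5)]]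
  by (simp add: algebra_simps)

lemma mu_sum_lincomb:
  assumes "1 \<le> conv_radius b" "1 \<le> conv_radius d" "0 < \<mu>" "0 < s" "s < 1"
  shows "mu_sum \<mu> (\<lambda>n. u * b n + v * d n) s = u * mu_sum \<mu> b s + v * mu_sum \<mu> d s"
proof -
  note sb = summable_mu_sum[OF assms(1,3-5)] and sd = summable_mu_sum[OF assms(2,3-5)]
  have "(\<Sum>n. u * (b (n + 2) * s powr (\<mu> * real (n + 2) - 1))
            + v * (d (n + 2) * s powr (\<mu> * real (n + 2) - 1)))
      = u * mu_sum \<mu> b s + v * mu_sum \<mu> d s"
    unfolding mu_sum_def
    by (simp only: suminf_mult[OF sb] suminf_mult[OF sd]
        flip: suminf_add[OF summable_mult[OF sb] summable_mult[OF sd]])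
  then show ?thesis unfolding mu_sum_def by (simp add: algebra_simps)
qed

lemma mu_sum_mono:
  assumes "1 \<le> conv_radius b" "1 \<le> conv_radius d" "0 < \<mu>" "0 < s" "s < 1"
    and "\<And>n. n \<ge> 2 \<Longrightarrow> b n \<le> d n"
  shows "mu_sum \<mu> b s \<le> mu_sum \<mu> d s"
  unfolding mu_sum_def
  by (intro suminf_le summable_mu_sum mult_right_mono assms) auto

lemma mu_tail_single:
  assumes "n \<ge> 2" "\<And>j. j \<ge> 2 \<Longrightarrow> j \<noteq> n \<Longrightarrow> b j = 0"
  shows "mu_tail \<mu> b z = of_real (b n) * z powr of_real (\<mu> * real n - 1)"
proof -
  have "b (j + 2) = 0" if "j \<notin> {n - 2}" for j using that assms by (intro assms(2)) auto
  then have "mu_tail \<mu> b z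
      = (\<Sum>j\<in>{n - 2}. of_real (b (j + 2)) * z powr of_real (\<mu> * real (j + 2) - 1))"
    unfolding mu_tail_def by (intro suminf_finite) auto
  also have "\<dots> = of_real (b (n - 2 + 2)) * z powr of_real (\<mu> * real (n - 2 + 2) - 1)" by simp
  also have "n - 2 + 2 = n" using assms(1) by simp
  finally show ?thesis .
qed

lemma mu_series_eq_mu_tail:
  assumes "1 \<le> conv_radius b" "0 < \<mu>" "0 < norm z" "norm z < 1"
    and c: "\<And>n. n \<ge> 2 \<Longrightarrow> c n = - of_real (b n)"
  shows "mu_series \<mu> c z = z * (1 - mu_tail \<mu> b z)"
proof -
  have "z \<noteq> 0" using assms by auto
  then have "c (n + 2) * z powr of_real (\<mu> * real (n + 2))
      = - z * (of_real (b (n + 2)) * z powr of_real (\<mu> * real (n + 2) - 1))" for n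
    using c[of "n + 2"] by (simp add: powr_diff)
  then have "mu_series \<mu> c z = z + - z * mu_tail \<mu> b z"
    unfolding mu_series_def mu_tail_def
    by (simp only: suminf_mult[OF summable_mu_tail[OF assms(1-4)]])
  then show ?thesis by (simp add: algebra_simps)
qed

lemma mu_deriv_eq_mu_tail:
  assumes "1 \<le> conv_radius b" "0 < \<mu>" "0 < norm z" "norm z < 1"
    and c: "\<And>n. n \<ge> 2 \<Longrightarrow> c n = - of_real (b n)"
  shows "mu_deriv \<mu> c z = 1 - mu_tail \<mu> (\<lambda>n. \<mu> * real n * b n) z"
proof -
  have "1 \<le> conv_radius (\<lambda>n. \<mu> * real n * b n)"
    using conv_radius_ge_1_mult[OF conv_radius_ge_1_linear_weight[of \<mu> 0] assms(1)] by simp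
  note sm = summable_mu_tail[OF this assms(2-4)]
  have "of_real (\<mu> * real (n + 2)) * c (n + 2) * z powr of_real (\<mu> * real (n + 2) - 1)
      = - (of_real (\<mu> * real (n + 2) * b (n + 2)) * z powr of_real (\<mu> * real (n + 2) - 1))" for n
    using c[of "n + 2"] by simp
  then show ?thesis unfolding mu_deriv_def mu_tail_def
    by (simp only: suminf_minus[OF sm] add_uminus_conv_diff)
qed

lemma mu_z_deriv2_eq_mu_tail:
  assumes "1 \<le> conv_radius b" "0 < \<mu>" "0 < norm z" "norm z < 1"
    and c: "\<And>n. n \<ge> 2 \<Longrightarrow> c n = - of_real (b n)"
  shows "mu_z_deriv2 \<mu> c z = - mu_tail \<mu> (\<lambda>n. \<mu> * real n * (\<mu> * real n - 1) * b n) z"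
proof -
  have "1 \<le> conv_radius (\<lambda>n. \<mu> * real n * (\<mu> * real n - 1) * b n)"
    using conv_radius_ge_1_mult[OF conv_radius_ge_1_mult[OF conv_radius_ge_1_linear_weight[of \<mu> 0]
          conv_radius_ge_1_linear_weight[of \<mu> "-1"]] assms(1)] by simp
  note sm = summable_mu_tail[OF this assms(2-4)]
  have "of_real (\<mu> * real (n + 2) * (\<mu> * real (n + 2) - 1)) * c (n + 2)
        * z powr of_real (\<mu> * real (n + 2) - 1)
      = - (of_real (\<mu> * real (n + 2) * (\<mu> * real (n + 2) - 1) * b (n + 2))
           * z powr of_real (\<mu> * real (n + 2) - 1))" for n
    using c[of "n + 2"] by simp
  then show ?thesis unfolding mu_z_deriv2_def mu_tail_def by (simp only: suminf_minus[OF sm])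
qed

text \<open>
  Continuity up to \<open>s = 0\<close> is read off from the factorisation
  \<open>s^(2\<mu> - 1) * (\<Sum>n. b (n + 2) * (s^\<mu>)^n)\<close> into a power and a power series in \<open>s^\<mu>\<close>.
\<close>

lemma continuous_on_mu_sum:
  assumes b: "1 \<le> conv_radius b" and \<mu>: "1 \<le> \<mu>" and "s < 1"
  shows "continuous_on {0..s} (mu_sum \<mu> b)"
proof -
  have factor: "mu_sum \<mu> b x = x powr (2 * \<mu> - 1) * (\<Sum>n. b (n + 2) * (x powr \<mu>) ^ n)"
    if x: "x \<in> {0..s}" for x
  proof (cases "x = 0")
    case True
    then show ?thesis by (simp add: mu_sum_def)
  next
    case False
    with x have "0 < x" "x < 1" using assms by auto
    have eq: "x powr (\<mu> * real (n + 2) - 1) = x powr (2 * \<mu> - 1) * (x powr \<mu>) ^ n" for n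
      using \<open>0 < x\<close> by (simp add: algebra_simps flip: powr_mu_eq_power powr_add)
    have "summable (\<lambda>n. x powr (2 * \<mu> - 1) * (b (n + 2) * (x powr \<mu>) ^ n))"
      using summable_mu_sum[OF b, of \<mu> x] \<mu> \<open>0 < x\<close> \<open>x < 1\<close>
      unfolding eq by (simp add: algebra_simps)
    then have "summable (\<lambda>n. b (n + 2) * (x powr \<mu>) ^ n)"
      using \<open>0 < x\<close> by (subst (asm) summable_cmult_iff) auto
    from suminf_mult[OF this, of "x powr (2 * \<mu> - 1)"] show ?thesis
      unfolding mu_sum_def eq by (simp add: algebra_simps)
  qed
  have "continuous_on {0..s} (\<lambda>x. x powr (2 * \<mu> - 1) * (\<Sum>n. b (n + 2) * (x powr \<mu>) ^ n))"
  proof (intro continuous_on_mult continuous_on_powr' continuous_intros ballI)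
    have pw: "continuous_on {0..s} (\<lambda>x. x powr \<mu>)"
      using \<mu> by (intro continuous_on_powr' continuous_intros) auto
    have shift: "conv_radius (\<lambda>n. b (n + 2)) = conv_radius b" by (rule conv_radius_shift)
    have ps: "continuous_on {0..<1} (\<lambda>y. \<Sum>n. b (n + 2) * y ^ n)"
    proof (intro continuous_at_imp_continuous_on ballI)
      fix y :: real assume y: "y \<in> {0..<1}"
      then obtain K where K: "y < K" "K < 1" using dense[of y 1] by auto
      have "ereal (norm K) < conv_radius (\<lambda>n. b (n + 2))" unfolding shift
        using K y by (intro less_le_trans[OF _ b]) (simp add: one_ereal_def)
      from summable_in_conv_radius[OF this] show "isCont (\<lambda>y. \<Sum>n. b (n + 2) * y ^ n) y"
        by (rule isCont_powser) (use K y in auto)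
    qed
    have "(\<lambda>x. x powr \<mu>) ` {0..s} \<subseteq> {0..<1}"
      using powr_less_mono2[of \<mu> _ 1] \<mu> \<open>s < 1\<close> by (fastforce simp: image_subset_iff)
    then show "continuous_on {0..s} (\<lambda>x. \<Sum>n. b (n + 2) * (x powr \<mu>) ^ n)"
      by (rule continuous_on_compose2[OF ps pw])
  qed (use \<mu> in auto)
  then show ?thesis by (rule continuous_on_eq) (simp only: factor)
qed

text \<open>
  Since \<open>mu_sum\<close> vanishes at \<open>0\<close>, the intermediate value theorem turns nonvanishing of the
  denominator \<open>1 - mu_sum \<mu> b s\<close> into positivity.
\<close>

lemma mu_sum_less_1:
  assumes b: "1 \<le> conv_radius b" and \<mu>: "1 \<le> \<mu>"
    and ne: "\<And>s. 0 < s \<Longrightarrow> s < 1 \<Longrightarrow> mu_sum \<mu> b s \<noteq> 1"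
    and s: "0 < s" "s < 1"
  shows "mu_sum \<mu> b s < 1"
proof (rule ccontr)
  assume "\<not> mu_sum \<mu> b s < 1"
  moreover have zero: "mu_sum \<mu> b 0 = 0" by (simp add: mu_sum_def)
  ultimately obtain x where x: "0 \<le> x" "x \<le> s" "mu_sum \<mu> b x = 1"
    using IVT'[of "mu_sum \<mu> b" 0 1 s] continuous_on_mu_sum[OF b \<mu> s(2)] s by auto
  with zero have "x \<noteq> 0" by auto
  with x ne[of x] s show False by auto
qed

section \<open>The coefficient bound for the class\<close>

text \<open>
  At a point of the positive axis, \<open>L\<close> and \<open>P\<close> are the values with \<open>q = (1 - P) / (1 - L)\<close>.  With
  \<open>t = 1 - q \<ge> 0\<close> the hypothesis reads \<open>t < |C + B t|\<close>; the case \<open>t < - (C + B t)\<close> would need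
  \<open>(1 + B) t < - C < 0\<close>, so \<open>(1 - B) t < C\<close>.
\<close>

lemma subordination_on_real_axis:
  fixes P L B C :: real and q d :: complex
  assumes "0 < C" "-1 \<le> B" "L < 1" "L \<le> P"
    and d: "d = of_real C - of_real B * (q - 1)"
    and q: "q = of_real ((1 - P) / (1 - L))"
    and "d \<noteq> 0" "norm ((q - 1) / d) < 1"
  shows "(1 - B) * (P - L) + C * L < C"
proof -
  define t where "t = (P - L) / (1 - L)"
  have "0 \<le> t" using assms by (simp add: t_def)
  have "(1 - P) / (1 - L) = 1 - t" using assms by (simp add: t_def field_simps)
  then have "q - 1 = complex_of_real (- t)" unfolding q by simp
  moreover from this have "d = complex_of_real (C + B * t)" by (simp add: d)
  ultimately have "\<bar>t\<bar> < \<bar>C + B * t\<bar>"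
    using assms(7,8) by (simp add: norm_divide divide_simps flip: of_real_mult of_real_add del: of_real_minus)
  moreover have "0 \<le> (1 + B) * t" using assms \<open>0 \<le> t\<close> by simp
  ultimately have "(1 - B) * t < C" using \<open>0 < C\<close> \<open>0 \<le> t\<close> by (auto simp: abs_if algebra_simps split: if_splits)
  then show ?thesis using assms(3) by (simp add: t_def field_simps)
qed

lemma sum_le_if_mu_sum_less:
  assumes b: "1 \<le> conv_radius b" "\<And>n. n \<ge> 2 \<Longrightarrow> 0 \<le> b n" and \<mu>: "0 < \<mu>"
    and lt: "\<And>s. 0 < s \<Longrightarrow> s < 1 \<Longrightarrow> mu_sum \<mu> b s < C"
  shows "summable (\<lambda>n. b (n + 2))" "(\<Sum>n. b (n + 2)) \<le> C"
proof -
  have partial: "(\<Sum>n<N. b (n + 2)) \<le> C" for N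
  proof -
    let ?g = "\<lambda>s. \<Sum>n<N. b (n + 2) * s powr (\<mu> * real (n + 2) - 1)"
    have "(?g \<longlongrightarrow> (\<Sum>n<N. b (n + 2) * 1 powr (\<mu> * real (n + 2) - 1))) (at_left 1)"
      by (intro tendsto_intros) auto
    then have lim: "(?g \<longlongrightarrow> (\<Sum>n<N. b (n + 2))) (at_left 1)" by simp
    have "eventually (\<lambda>s. s \<in> {0<..<1}) (at_left (1 :: real))"
      by (rule eventually_at_left_1) simp
    then have "eventually (\<lambda>s. ?g s \<le> C) (at_left 1)"
    proof eventually_elim
      case (elim s)
      have "?g s \<le> mu_sum \<mu> b s" unfolding mu_sum_def
        using elim \<mu> b by (intro sum_le_suminf summable_mu_sum) auto
      also have "\<dots> < C" using elim lt by auto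
      finally show ?case by simp
    qed
    with lim show ?thesis by (intro tendsto_upperbound[OF lim]) auto
  qed
  show "summable (\<lambda>n. b (n + 2))" using b partial by (intro summableI_nonneg_bounded) auto
  then show "(\<Sum>n. b (n + 2)) \<le> C" using partial by (intro suminf_le_const)
qed

text \<open>For members of \<open>class_X\<close> the moduli of the coefficients are the numbers \<open>a n\<close> themselves.\<close>

lemma class_X_coeff:
  assumes "F \<in> class_X \<mu>" "n \<ge> 2"
  shows "F n = - of_real (norm (F n))"
  using assms by (auto simp: class_X_def)

lemma mu_D_conv_eq_mu_tail:
  assumes \<mu>: "1 \<le> \<mu>" and z: "0 < norm z" "norm z < 1"
    and a: "1 \<le> conv_radius a" "\<And>n. n \<ge> 2 \<Longrightarrow> F n = - of_real (a n)"
    and t: "1 \<le> conv_radius t"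
  shows "mu_series \<mu> (mu_D \<mu> j (mu_conv F (\<lambda>n. of_real (t n)))) z
    = z * (1 - mu_tail \<mu> (\<lambda>n. (\<mu> * real n) ^ j * t n * a n) z)"
  using \<mu> z a
  by (intro mu_series_eq_mu_tail conv_radius_ge_1_mult conv_radius_ge_1_power_weight t)
     (auto simp: mu_D_def mu_conv_def)

lemma class_E_tilde_coeff_bound:
  fixes \<theta> lam :: "nat \<Rightarrow> real" and F :: "nat \<Rightarrow> complex"
  assumes \<mu>: "1 \<le> \<mu>" and C: "0 < (A - B) * (1 - \<gamma>)" and B: "-1 \<le> B" "B < 0" and km: "m \<le> k"
    and \<theta>: "1 \<le> conv_radius \<theta>" and lam: "1 \<le> conv_radius lam"
    and ord: "\<And>n. n \<ge> 2 \<Longrightarrow> 0 \<le> lam n \<and> lam n \<le> \<theta> n"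
    and \<Xi>: "\<Xi> = (\<lambda>n. (1 - B) * ((\<mu> * real n) ^ k * \<theta> n - (\<mu> * real n) ^ m * lam n)
                   + (A - B) * (1 - \<gamma>) * (\<mu> * real n) ^ m * lam n)"
    and F: "F \<in> class_E_tilde k m (\<lambda>n. of_real (\<theta> n)) (\<lambda>n. of_real (lam n)) A B \<mu> \<gamma>"
  shows "summable (\<lambda>n. \<Xi> (n + 2) * norm (F (n + 2)))"
    and "(\<Sum>n. \<Xi> (n + 2) * norm (F (n + 2))) \<le> (A - B) * (1 - \<gamma>)"
proof -
  define a where "a = (\<lambda>n. norm (F n))"
  define p where "p = (\<lambda>n. (\<mu> * real n) ^ k * \<theta> n * a n)"
  define l where "l = (\<lambda>n. (\<mu> * real n) ^ m * lam n * a n)"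
  define C where "C = (A - B) * (1 - \<gamma>)"
  have F': "F \<in> class_X \<mu>" "F \<in> class_A \<mu>"
    using F by (auto simp: class_E_tilde_def class_X_def)
  have Fa: "F n = - of_real (a n)" if "n \<ge> 2" for n
    using class_X_coeff[OF F'(1) that] by (simp add: a_def)
  have a: "1 \<le> conv_radius a"
    using F'(2) class_A_iff_conv_radius[OF \<mu>] by (simp add: a_def)
  have p: "1 \<le> conv_radius p" and l: "1 \<le> conv_radius l" unfolding p_def l_def
    by (intro conv_radius_ge_1_mult conv_radius_ge_1_power_weight \<theta> lam a)+
  have pow: "(\<mu> * real n) ^ m \<le> (\<mu> * real n) ^ k" if "n \<ge> 2" for n
    using mu_index_ge_2[OF \<mu> that] km by (intro power_increasing) auto
  have lp: "0 \<le> l n" "l n \<le> p n" if "n \<ge> 2" for n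
    unfolding p_def l_def using ord[OF that] pow[OF that] \<mu>
    by (auto simp: a_def intro!: mult_mono)
  have \<Xi>a: "\<Xi> n * a n = (1 - B) * p n + (C - (1 - B)) * l n" for n
    by (simp add: \<Xi> p_def l_def C_def algebra_simps)
  have cls: "mu_series \<mu> (mu_D \<mu> m (mu_conv F (\<lambda>n. of_real (lam n)))) z \<noteq> 0 \<and>
        (let q = mu_series \<mu> (mu_D \<mu> k (mu_conv F (\<lambda>n. of_real (\<theta> n)))) z
                   / mu_series \<mu> (mu_D \<mu> m (mu_conv F (\<lambda>n. of_real (lam n)))) z;
             d = of_real C - of_real B * (q - 1)
         in d \<noteq> 0 \<and> norm ((q - 1) / d) < 1)" if "0 < norm z" "norm z < 1" for z
    using F that unfolding class_E_tilde_def class_E_def C_def by blast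
  have on_axis: "mu_series \<mu> (mu_D \<mu> k (mu_conv F (\<lambda>n. of_real (\<theta> n)))) (of_real s)
        = of_real s * of_real (1 - mu_sum \<mu> p s)"
      "mu_series \<mu> (mu_D \<mu> m (mu_conv F (\<lambda>n. of_real (lam n)))) (of_real s)
        = of_real s * of_real (1 - mu_sum \<mu> l s)" if "0 < s" "s < 1" for s
    using that \<mu> mu_tail_of_real[OF p, of \<mu> s] mu_tail_of_real[OF l, of \<mu> s]
    by (simp_all add: mu_D_conv_eq_mu_tail[OF \<mu> _ _ a Fa] \<theta> lam p_def l_def)
  have L: "mu_sum \<mu> l s < 1" if "0 < s" "s < 1" for s
  proof (rule mu_sum_less_1[OF l \<mu> _ that])
    fix s :: real assume s: "0 < s" "s < 1"
    then show "mu_sum \<mu> l s \<noteq> 1" using cls[of "of_real s"] on_axis(2)[OF s] by auto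
  qed
  have lt: "mu_sum \<mu> (\<lambda>n. \<Xi> n * a n) s < C" if s: "0 < s" "s < 1" for s
  proof -
    define q where "q = complex_of_real ((1 - mu_sum \<mu> p s) / (1 - mu_sum \<mu> l s))"
    have "mu_sum \<mu> l s \<le> mu_sum \<mu> p s" using lp \<mu> s by (intro mu_sum_mono l p) auto
    moreover have "of_real C - of_real B * (q - 1) \<noteq> 0 \<and>
        norm ((q - 1) / (of_real C - of_real B * (q - 1))) < 1"
    proof -
      have "mu_series \<mu> (mu_D \<mu> k (mu_conv F (\<lambda>n. of_real (\<theta> n)))) (of_real s)
          / mu_series \<mu> (mu_D \<mu> m (mu_conv F (\<lambda>n. of_real (lam n)))) (of_real s) = q"
        unfolding on_axis[OF s] q_def using s by simp
      then show ?thesis using cls[of "of_real s"] s by (simp add: Let_def)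
    qed
    ultimately have "(1 - B) * (mu_sum \<mu> p s - mu_sum \<mu> l s) + C * mu_sum \<mu> l s < C"
      using subordination_on_real_axis[OF _ B(1) L[OF s] _ refl q_def] C
      unfolding C_def by blast
    then show ?thesis
      using mu_sum_lincomb[OF p l, of \<mu> s "1 - B" "C - (1 - B)"] \<mu> s
      unfolding \<Xi>a by (simp add: algebra_simps)
  qed
  have cr: "1 \<le> conv_radius (\<lambda>n. \<Xi> n * a n)"
    unfolding \<Xi>a by (rule conv_radius_ge_1_lincomb[OF p l])
  have nonneg: "0 \<le> \<Xi> n * a n" if "n \<ge> 2" for n
  proof -
    have "\<Xi> n * a n = (1 - B) * (p n - l n) + C * l n" by (simp add: \<Xi>a algebra_simps)
    then show ?thesis using lp[OF that] B C unfolding C_def by simp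
  qed
  show "summable (\<lambda>n. \<Xi> (n + 2) * norm (F (n + 2)))"
    and "(\<Sum>n. \<Xi> (n + 2) * norm (F (n + 2))) \<le> (A - B) * (1 - \<gamma>)"
    using sum_le_if_mu_sum_less[OF cr nonneg _ lt] \<mu> by (auto simp: a_def C_def)
qed

section \<open>Weighted coefficient bounds imply the three properties\<close>

text \<open>
  The triangle inequality gives \<open>|z F' - F| \<le> s * (\<Sum>n. (\<mu> n - 1) * a n * s^(\<mu> n - 1))\<close> and
  \<open>|F| \<ge> s * (1 - (\<Sum>n. a n * s^(\<mu> n - 1)))\<close> on \<open>|z| = s\<close>.  As \<open>\<mu> n - \<psi> = (\<mu> n - 1) + (1 - \<psi>)\<close>, the
  hypothesis says precisely that the first is less than \<open>1 - \<psi>\<close> times the second, so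
  \<open>z F' / F\<close> lies within \<open>1 - \<psi>\<close> of \<open>1\<close>.
\<close>

lemma starlike_if_weighted_sum:
  assumes \<mu>: "1 \<le> \<mu>" and \<psi>: "\<psi> < 1"
    and F: "\<And>n. n \<ge> 2 \<Longrightarrow> F n = - of_real (a n)"
    and a: "1 \<le> conv_radius a" "\<And>n. n \<ge> 2 \<Longrightarrow> 0 \<le> a n"
    and lt: "\<And>s. 0 < s \<Longrightarrow> s < r \<Longrightarrow> s < 1 \<Longrightarrow> mu_sum \<mu> (\<lambda>n. (\<mu> * real n - \<psi>) * a n) s < 1 - \<psi>"
  shows "starlike_of_order \<mu> F \<psi> r"
  unfolding starlike_of_order_def
proof (intro allI impI, elim conjE)
  fix z :: complex assume z: "0 < norm z" "norm z < r" "norm z < 1"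
  let ?b = "\<lambda>n. (\<mu> * real n - 1) * a n"
  have b: "1 \<le> conv_radius ?b"
    using conv_radius_ge_1_mult[OF conv_radius_ge_1_linear_weight[of \<mu> "-1"] a(1)] by simp
  have b_nonneg: "0 \<le> ?b n" if "n \<ge> 2" for n
    using a(2)[OF that] mu_index_ge_2[OF \<mu> that] by simp
  have \<mu>0: "0 < \<mu>" using \<mu> by simp
  define Q where "Q = mu_tail \<mu> ?b z"
  define T where "T = mu_tail \<mu> a z"
  have Q: "norm Q \<le> mu_sum \<mu> ?b (norm z)"
    using norm_mu_tail_le[OF b b_nonneg \<mu>0 z(1,3)] by (simp add: Q_def)
  have T: "norm T \<le> mu_sum \<mu> a (norm z)"
    using norm_mu_tail_le[OF a \<mu>0 z(1,3)] by (simp add: T_def)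
  have "mu_sum \<mu> (\<lambda>n. 1 * ?b n + (1 - \<psi>) * a n) (norm z) < 1 - \<psi>"
    using lt[OF z] by (simp add: algebra_simps)
  then have "mu_sum \<mu> ?b (norm z) < (1 - \<psi>) * (1 - mu_sum \<mu> a (norm z))"
    unfolding mu_sum_lincomb[OF b a(1) \<mu>0 z(1,3)] by (simp add: algebra_simps)
  also have "\<dots> \<le> (1 - \<psi>) * norm (1 - T)"
    using T norm_triangle_ineq2[of 1 T] \<psi> by (intro mult_left_mono) auto
  finally have lt': "norm Q < (1 - \<psi>) * norm (1 - T)" using Q by linarith
  then have nz: "1 - T \<noteq> 0" by auto
  have series: "mu_series \<mu> F z = z * (1 - T)"
    using mu_series_eq_mu_tail[OF a(1) \<mu>0 z(1,3) F] by (simp add: T_def)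
  have "mu_tail \<mu> (\<lambda>n. ?b n + a n) z = Q + T"
    unfolding Q_def T_def by (rule mu_tail_add[OF b a(1) \<mu>0 z(1,3)])
  then have "mu_deriv \<mu> F z = 1 - (Q + T)"
    using mu_deriv_eq_mu_tail[OF a(1) \<mu>0 z(1,3) F] by (simp add: algebra_simps)
  then have quot: "z * mu_deriv \<mu> F z / mu_series \<mu> F z = 1 - Q / (1 - T)"
    using z nz by (simp add: series divide_simps)
  have "norm (Q / (1 - T)) < 1 - \<psi>" using lt' nz by (simp add: norm_divide divide_simps)
  then have "Re (Q / (1 - T)) < 1 - \<psi>" using complex_Re_le_cmod order_le_less_trans by blast
  then show "mu_series \<mu> F z \<noteq> 0 \<and> \<psi> < Re (z * mu_deriv \<mu> F z / mu_series \<mu> F z)"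
    unfolding quot using nz z by (auto simp: series)
qed

text \<open>
  Alexander's relation: \<open>mu_D \<mu> 1 F\<close> is \<open>G = z F'\<close>, and
  \<open>z G' / G = (F' + z F'') / F' = 1 + z F'' / F'\<close>.
\<close>

lemma convex_iff_starlike:
  assumes \<mu>: "1 \<le> \<mu>"
    and F: "\<And>n. n \<ge> 2 \<Longrightarrow> F n = - of_real (a n)"
    and a: "1 \<le> conv_radius a"
  shows "convex_of_order \<mu> F \<psi> r \<longleftrightarrow> starlike_of_order \<mu> (mu_D \<mu> 1 F) \<psi> r"
proof -
  let ?b = "\<lambda>n. \<mu> * real n * a n"
  let ?c = "\<lambda>n. \<mu> * real n * (\<mu> * real n - 1) * a n"
  have b: "1 \<le> conv_radius ?b"
    using conv_radius_ge_1_mult[OF conv_radius_ge_1_linear_weight[of \<mu> 0] a] by simp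
  have c: "1 \<le> conv_radius ?c"
    using conv_radius_ge_1_mult[OF conv_radius_ge_1_linear_weight[of \<mu> "-1"] b]
    by (simp add: algebra_simps)
  have \<mu>0: "0 < \<mu>" using \<mu> by simp
  have G: "mu_D \<mu> 1 F n = - of_real (?b n)" if "n \<ge> 2" for n
    using F[OF that] by (simp add: mu_D_def)
  have "mu_series \<mu> (mu_D \<mu> 1 F) z = z * mu_deriv \<mu> F z"
    and "mu_deriv \<mu> (mu_D \<mu> 1 F) z = mu_deriv \<mu> F z + mu_z_deriv2 \<mu> F z"
    if z: "0 < norm z" "norm z < 1" for z
  proof -
    note dF = mu_deriv_eq_mu_tail[OF a \<mu>0 z F]
    show "mu_series \<mu> (mu_D \<mu> 1 F) z = z * mu_deriv \<mu> F z"
      using mu_series_eq_mu_tail[OF b \<mu>0 z G] dF by simp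
    have "mu_deriv \<mu> (mu_D \<mu> 1 F) z = 1 - mu_tail \<mu> (\<lambda>n. ?b n + ?c n) z"
      using mu_deriv_eq_mu_tail[OF b \<mu>0 z G] by (simp add: algebra_simps)
    then show "mu_deriv \<mu> (mu_D \<mu> 1 F) z = mu_deriv \<mu> F z + mu_z_deriv2 \<mu> F z"
      using mu_tail_add[OF b c \<mu>0 z] dF mu_z_deriv2_eq_mu_tail[OF a \<mu>0 z F] by simp
  qed
  then show ?thesis
    unfolding convex_of_order_def starlike_of_order_def
    by (intro all_cong) (auto simp: add_divide_distrib)
qed

lemma close_to_convex_if_weighted_sum:
  assumes \<mu>: "1 \<le> \<mu>"
    and F: "\<And>n. n \<ge> 2 \<Longrightarrow> F n = - of_real (a n)"
    and a: "1 \<le> conv_radius a" "\<And>n. n \<ge> 2 \<Longrightarrow> 0 \<le> a n"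
    and lt: "\<And>s. 0 < s \<Longrightarrow> s < r \<Longrightarrow> s < 1 \<Longrightarrow> mu_sum \<mu> (\<lambda>n. \<mu> * real n * a n) s < 1 - \<psi>"
  shows "close_to_convex_of_order \<mu> F \<psi> r"
  unfolding close_to_convex_of_order_def
proof (intro allI impI, elim conjE)
  fix z :: complex assume z: "0 < norm z" "norm z < r" "norm z < 1"
  let ?b = "\<lambda>n. \<mu> * real n * a n"
  have b: "1 \<le> conv_radius ?b"
    using conv_radius_ge_1_mult[OF conv_radius_ge_1_linear_weight[of \<mu> 0] a(1)] by simp
  have \<mu>0: "0 < \<mu>" using \<mu> by simp
  have "Re (mu_tail \<mu> ?b z) \<le> norm (mu_tail \<mu> ?b z)" by (rule complex_Re_le_cmod)
  also have "\<dots> \<le> mu_sum \<mu> ?b (norm z)" using \<mu>0 a(2) z by (intro norm_mu_tail_le b) auto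
  also have "\<dots> < 1 - \<psi>" using lt z by blast
  finally show "\<psi> < Re (mu_deriv \<mu> F z)"
    using mu_deriv_eq_mu_tail[OF a(1) \<mu>0 z(1,3) F] by simp
qed

section \<open>The radii\<close>

text \<open>
  Here \<open>X n = \<Xi> n / C\<close>, \<open>w\<close> is the weight of the property in question and \<open>\<kappa> = 1 - \<psi>\<close>.  Up to the
  radius every term satisfies \<open>w n * a n * s^(\<mu> n - 1) \<le> \<kappa> * X n * a n\<close>.  Applying this at
  an intermediate \<open>s'\<close> with \<open>s < s' < r\<close> gains the factor \<open>s / s' < 1\<close>, all exponents being at
  least \<open>1\<close>; hence the strict inequality.
\<close>

lemma weighted_sum_lt_inside_radius:
  fixes a X w Y :: "nat \<Rightarrow> real"
  assumes \<mu>: "1 \<le> \<mu>" and \<kappa>: "0 < \<kappa>"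
    and pos: "\<And>n. n \<ge> 2 \<Longrightarrow> 0 \<le> a n \<and> 0 \<le> X n \<and> 0 \<le> Y n \<and> 0 < w n \<and> w n * Y n = \<kappa> * X n"
    and sm: "summable (\<lambda>n. X (n + 2) * a (n + 2))" and le: "(\<Sum>n. X (n + 2) * a (n + 2)) \<le> 1"
    and r: "r = (INF n\<in>{2..}. Y n powr (1 / (\<mu> * real n - 1)))"
    and s: "0 < s" "s < r"
  shows "mu_sum \<mu> (\<lambda>n. w n * a n) s < \<kappa>"
proof -
  obtain s' where s': "s < s'" "s' < r" using dense[OF s(2)] by blast
  have bound: "w n * a n * s powr (\<mu> * real n - 1) \<le> \<kappa> * (s / s') * (X n * a n)"
    if n: "n \<ge> 2" for n
  proof -
    define e where "e = \<mu> * real n - 1"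
    have e: "1 \<le> e" using mu_index_ge_2[OF \<mu> n] by (simp add: e_def)
    have "s' \<le> Y n powr (1 / e)"
    proof -
      have "r \<le> Y n powr (1 / e)" unfolding r e_def
        using n by (intro cINF_lower) (auto intro!: bdd_belowI[of _ 0])
      with s' show ?thesis by linarith
    qed
    then have "s' powr e \<le> (Y n powr (1 / e)) powr e"
      using s s' e by (intro powr_mono2) auto
    then have Y: "s' powr e \<le> Y n" using e pos[OF n] by (simp add: powr_powr)
    have "s powr e = (s / s') powr e * s' powr e" using s s' by (simp add: powr_divide)
    also have "(s / s') powr e \<le> (s / s') powr 1"
      using s s' e by (intro powr_mono') auto
    also have "(s / s') powr 1 * s' powr e \<le> (s / s') * Y n"
      using s s' Y by (simp add: mult_left_mono divide_right_mono)
    finally have "s powr e \<le> (s / s') * Y n" by (simp add: mult_right_mono)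
    then have "w n * a n * s powr e \<le> w n * a n * ((s / s') * Y n)"
      using pos[OF n] by (intro mult_left_mono) auto
    also have "\<dots> = (w n * Y n) * (s / s') * a n" by (simp add: field_simps)
    also have "\<dots> = \<kappa> * (s / s') * (X n * a n)" using pos[OF n] by simp
    finally show ?thesis by (simp add: e_def)
  qed
  have sm': "summable (\<lambda>n. \<kappa> * (s / s') * (X (n + 2) * a (n + 2)))"
    by (rule summable_mult[OF sm])
  have "mu_sum \<mu> (\<lambda>n. w n * a n) s \<le> (\<Sum>n. \<kappa> * (s / s') * (X (n + 2) * a (n + 2)))"
    unfolding mu_sum_def
  proof (rule suminf_le[OF bound _ sm'])
    show "summable (\<lambda>n. w (n + 2) * a (n + 2) * s powr (\<mu> * real (n + 2) - 1))"
    proof (rule summable_comparison_test'[OF sm'])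
      fix n
      have "0 \<le> w (n + 2) * a (n + 2) * s powr (\<mu> * real (n + 2) - 1)"
        using pos[of "n + 2"] by simp
      then show "norm (w (n + 2) * a (n + 2) * s powr (\<mu> * real (n + 2) - 1))
          \<le> \<kappa> * (s / s') * (X (n + 2) * a (n + 2))"
        using bound[of "n + 2"] by simp
    qed
  qed simp
  also have "\<dots> = \<kappa> * (s / s') * (\<Sum>n. X (n + 2) * a (n + 2))" by (rule suminf_mult[OF sm])
  also have "\<dots> \<le> \<kappa> * (s / s') * 1" using le \<kappa> s s' by (intro mult_left_mono) auto
  also have "\<dots> < \<kappa>" using \<kappa> s s' by (simp add: field_simps)
  finally show ?thesis .
qed

lemma radius_exceeded:
  fixes Y :: "nat \<Rightarrow> real"
  assumes \<mu>: "1 \<le> \<mu>" and Y: "\<And>n. n \<ge> 2 \<Longrightarrow> 0 < Y n"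
    and r: "(INF n\<in>{2..}. Y n powr (1 / (\<mu> * real n - 1))) < \<rho>"
  obtains n t where "n \<ge> 2" "0 < t" "t < \<rho>" "t powr (\<mu> * real n - 1) = Y n"
proof -
  have "bdd_below ((\<lambda>n. Y n powr (1 / (\<mu> * real n - 1))) ` {2..})"
    by (auto intro!: bdd_belowI[of _ 0])
  with r obtain n where n: "n \<ge> 2" "Y n powr (1 / (\<mu> * real n - 1)) < \<rho>"
    by (subst (asm) cINF_less_iff) auto
  have "1 \<le> \<mu> * real n - 1" using mu_index_ge_2[OF \<mu> n(1)] by simp
  then have "(Y n powr (1 / (\<mu> * real n - 1))) powr (\<mu> * real n - 1) = Y n"
    using Y[OF n(1)] by (simp add: powr_powr)
  with n Y[OF n(1)] show thesis by (intro that[of n "Y n powr (1 / (\<mu> * real n - 1))"]) auto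
qed

section \<open>Extremal functions\<close>

lemma conv_radius_single: "1 \<le> conv_radius (\<lambda>j. if j = n then x else (0 :: real))"
  by (rule conv_radius_ge_1_bounded[where K = "\<bar>x\<bar>"]) simp

text \<open>
  With \<open>w = z^(\<mu> n - 1)\<close> the quotient of the class is \<open>(1 - p w) / (1 - l w)\<close>, where
  \<open>(1 - B) (p - l) + C l = C\<close> expresses the choice of the coefficient.  The modulus of
  \<open>C (1 - l w) + B (p - l) w\<close> is at least \<open>C - (C - (p - l)) |w|\<close>, which exceeds
  \<open>(p - l) |w|\<close> because \<open>|w| < 1\<close>.
\<close>

lemma extremal_quotient_subordinate:
  fixes p l B C :: real and w :: complex
  assumes "0 < C" "B < 0" "0 \<le> l" "l \<le> p" "(1 - B) * (p - l) + C * l = C" "norm w < 1"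
    and q: "q = (1 - of_real p * w) / (1 - of_real l * w)"
    and d: "d = of_real C - of_real B * (q - 1)"
  shows "l \<le> 1" "1 - of_real l * w \<noteq> 0" "d \<noteq> 0" "norm ((q - 1) / d) < 1"
proof -
  have "0 \<le> (1 - B) * (p - l)" using assms by simp
  then have "C * l \<le> C * 1" using assms(5) by linarith
  then show "l \<le> 1" using assms(1) by simp
  then have "l * norm w < 1"
    using assms mult_right_mono[of l 1 "norm w"] by (auto intro: order_le_less_trans)
  moreover have "norm (of_real l * w) = l * norm w" using assms by (simp add: norm_mult)
  ultimately show nz: "1 - of_real l * w \<noteq> 0" by auto
  define E where "E = of_real C - of_real (C * l - B * (p - l)) * w"
  have q1: "q - 1 = - of_real (p - l) * w / (1 - of_real l * w)"
    using nz by (simp add: q field_simps)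
  have dE: "d = E / (1 - of_real l * w)"
    unfolding d q1 E_def using nz by (simp add: field_simps)
  have coef: "C * l - B * (p - l) = C - (p - l)" using assms(5) by (simp add: algebra_simps)
  have "0 \<le> C - (p - l)" unfolding coef[symmetric]
    using assms(1-4) mult_nonpos_nonneg[of B "p - l"] mult_nonneg_nonneg[of C l] by linarith
  then have "C - (C - (p - l)) * norm w \<le> norm E" unfolding E_def coef
    using norm_triangle_ineq2[of "of_real C" "of_real (C - (p - l)) * w"] assms(1)
    by (simp add: norm_mult del: of_real_diff)
  moreover have "0 < C * (1 - norm w)" using assms by simp
  ultimately have lt: "(p - l) * norm w < norm E" by (simp add: algebra_simps)
  moreover have "0 \<le> (p - l) * norm w" using assms by simp
  ultimately have "E \<noteq> 0" by auto
  then show "d \<noteq> 0" using nz by (simp add: dE)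
  have "(q - 1) / d = - (of_real (p - l) * w) / E"
    unfolding q1 dE using nz by (simp del: of_real_diff)
  then have "norm ((q - 1) / d) = (p - l) * norm w / norm E"
    using assms(4) by (simp add: norm_divide norm_mult del: of_real_diff)
  also have "\<dots> < 1" using lt \<open>E \<noteq> 0\<close> by simp
  finally show "norm ((q - 1) / d) < 1" .
qed

lemma extremal_in_class_E_tilde:
  fixes \<theta> lam :: "nat \<Rightarrow> real"
  assumes \<mu>: "1 \<le> \<mu>" and C: "0 < (A - B) * (1 - \<gamma>)" and B: "B < 0" and km: "m \<le> k"
    and \<theta>: "1 \<le> conv_radius \<theta>" and lam: "1 \<le> conv_radius lam"
    and n: "n \<ge> 2" and ord: "0 \<le> lam n" "lam n \<le> \<theta> n"
    and \<Xi>: "\<Xi> = (1 - B) * ((\<mu> * real n) ^ k * \<theta> n - (\<mu> * real n) ^ m * lam n)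
                   + (A - B) * (1 - \<gamma>) * (\<mu> * real n) ^ m * lam n" "0 < \<Xi>"
    and F: "F = (\<lambda>j. if j = n then - of_real ((A - B) * (1 - \<gamma>) / \<Xi>) else 0)"
  shows "F \<in> class_E_tilde k m (\<lambda>n. of_real (\<theta> n)) (\<lambda>n. of_real (lam n)) A B \<mu> \<gamma>"
proof -
  define C where "C = (A - B) * (1 - \<gamma>)"
  define x where "x = C / \<Xi>"
  define a where "a = (\<lambda>j. if j = n then x else 0)"
  have x: "0 < x" using C \<Xi>(2) by (simp add: x_def C_def)
  have Fa: "F j = - of_real (a j)" for j by (simp add: F a_def x_def C_def)
  have a: "1 \<le> conv_radius a" unfolding a_def by (rule conv_radius_single)
  have "conv_radius F = conv_radius (\<lambda>j. complex_of_real (a j))"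
    by (rule conv_radius_cong) (simp add: Fa)
  with a have "1 \<le> conv_radius F" by (simp only: conv_radius_of_real)
  then have A: "F \<in> class_A \<mu>" using class_A_iff_conv_radius[OF \<mu>] by simp
  have X: "F \<in> class_X \<mu>" unfolding class_X_def using A x
    by (auto simp: Fa a_def intro!: exI[of _ a])
  define p where "p = (\<mu> * real n) ^ k * \<theta> n * x"
  define l where "l = (\<mu> * real n) ^ m * lam n * x"
  note \<mu>n = mu_index_ge_2[OF \<mu> n]
  have "(\<mu> * real n) ^ m \<le> (\<mu> * real n) ^ k" using \<mu>n km by (intro power_increasing) auto
  then have lp: "0 \<le> l" "l \<le> p" unfolding p_def l_def using ord \<mu>n x by (auto intro!: mult_mono)
  have "(1 - B) * (p - l) + C * l = \<Xi> * x"
    by (simp add: \<Xi>(1) p_def l_def C_def algebra_simps)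
  then have eq: "(1 - B) * (p - l) + C * l = C" using \<Xi>(2) by (simp add: x_def)
  have "mu_series \<mu> (mu_conv F (\<lambda>n. of_real (lam n))) z \<noteq> 0 \<and>
        mu_series \<mu> (mu_D \<mu> m (mu_conv F (\<lambda>n. of_real (lam n)))) z \<noteq> 0 \<and>
        (let q = mu_series \<mu> (mu_D \<mu> k (mu_conv F (\<lambda>n. of_real (\<theta> n)))) z
                   / mu_series \<mu> (mu_D \<mu> m (mu_conv F (\<lambda>n. of_real (lam n)))) z;
             d = of_real C - of_real B * (q - 1)
         in d \<noteq> 0 \<and> norm ((q - 1) / d) < 1)" if z: "0 < norm z" "norm z < 1" for z
  proof -
    define w where "w = z powr of_real (\<mu> * real n - 1)"
    have w: "norm w < 1"
      using powr_less_mono2[of "\<mu> * real n - 1" "norm z" 1] z \<mu>n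
      by (simp add: w_def norm_powr_real_powr')
    have series: "mu_series \<mu> (mu_D \<mu> j (mu_conv F (\<lambda>n. of_real (t n)))) z
        = z * (1 - of_real ((\<mu> * real n) ^ j * t n * x) * w)" if "1 \<le> conv_radius t" for j t
    proof -
      have "mu_tail \<mu> (\<lambda>i. (\<mu> * real i) ^ j * t i * a i) z
          = of_real ((\<mu> * real n) ^ j * t n * a n) * w"
        unfolding w_def by (rule mu_tail_single[OF n]) (simp add: a_def)
      then show ?thesis using mu_D_conv_eq_mu_tail[OF \<mu> z a Fa that] by (simp add: a_def)
    qed
    have conv: "mu_conv F (\<lambda>n. of_real (lam n)) = mu_D \<mu> 0 (mu_conv F (\<lambda>n. of_real (lam n)))"
      by (simp add: mu_D_def fun_eq_iff)
    note sub = extremal_quotient_subordinate[OF _ B lp eq w refl refl]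
    have C0: "0 < C" using C by (simp add: C_def)
    \<comment> \<open>Nonvanishing of the convolution without multiplier: its coefficient is at most \<open>l \<le> 1\<close>.\<close>
    have "lam n * x \<le> l"
      using \<mu>n ord x mult_right_mono[of 1 "(\<mu> * real n) ^ m" "lam n * x"]
      by (simp add: l_def mult.assoc)
    then have "lam n * x \<le> 1" using sub(1)[OF C0] by linarith
    then have "\<bar>lam n * x\<bar> \<le> 1" using ord x by simp
    then have "norm (of_real (lam n * x) * w) \<le> 1 * norm w"
      unfolding norm_mult norm_of_real by (intro mult_right_mono) auto
    with w have nz0: "1 - of_real (lam n * x) * w \<noteq> 0" by auto
    have z0: "z \<noteq> 0" using z by auto
    have s0: "mu_series \<mu> (mu_conv F (\<lambda>n. of_real (lam n))) z = z * (1 - of_real (lam n * x) * w)"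
      by (subst conv, subst series[OF lam]) simp
    have sk: "mu_series \<mu> (mu_D \<mu> k (mu_conv F (\<lambda>n. of_real (\<theta> n)))) z = z * (1 - of_real p * w)"
      unfolding p_def by (rule series[OF \<theta>])
    have sm: "mu_series \<mu> (mu_D \<mu> m (mu_conv F (\<lambda>n. of_real (lam n)))) z = z * (1 - of_real l * w)"
      unfolding l_def by (rule series[OF lam])
    have quot: "z * (1 - of_real p * w) / (z * (1 - of_real l * w))
        = (1 - of_real p * w) / (1 - of_real l * w)" using z0 by simp
    show ?thesis
      unfolding s0 sk sm quot Let_def using sub(2-4)[OF C0] nz0 z0 by simp
  qed
  then show ?thesis using A X by (simp add: class_E_tilde_def class_E_def C_def)
qed

text \<open>
  With \<open>y = x t^(\<mu> n - 1) = (1 - \<psi>) / (\<mu> n - \<psi>)\<close> one has \<open>t F' / F = (1 - \<mu> n y) / (1 - y) = \<psi>\<close>.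
\<close>

lemma monomial_not_starlike:
  assumes \<mu>: "1 \<le> \<mu>" and \<psi>: "0 \<le> \<psi>" "\<psi> < 1" and n: "n \<ge> 2"
    and F: "F = (\<lambda>j. if j = n then - of_real x else 0)"
    and t: "0 < t" "t < \<rho>" "\<rho> \<le> 1"
    and eq: "(\<mu> * real n - \<psi>) * (x * t powr (\<mu> * real n - 1)) = 1 - \<psi>"
  shows "\<not> starlike_of_order \<mu> F \<psi> \<rho>"
proof -
  define a where "a = (\<lambda>j. if j = n then x else 0)"
  have a: "1 \<le> conv_radius a" unfolding a_def by (rule conv_radius_single)
  have Fa: "F j = - of_real (a j)" for j by (simp add: F a_def)
  note \<mu>n = mu_index_ge_2[OF \<mu> n]
  define y where "y = x * t powr (\<mu> * real n - 1)"
  have y: "y = (1 - \<psi>) / (\<mu> * real n - \<psi>)" using eq \<mu>n \<psi> by (simp add: y_def field_simps)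
  have pw: "complex_of_real t powr of_real (\<mu> * real n - 1) = of_real (t powr (\<mu> * real n - 1))"
    using t by (subst powr_of_real) auto
  have "mu_tail \<mu> a (of_real t) = of_real y"
    using mu_tail_single[OF n, of a \<mu> "of_real t"] by (simp add: a_def pw y_def del: of_real_diff)
  then have series: "mu_series \<mu> F (of_real t) = of_real (t * (1 - y))"
    using mu_series_eq_mu_tail[OF a, of \<mu> "of_real t" F] Fa \<mu> t by simp
  have "mu_tail \<mu> (\<lambda>j. \<mu> * real j * a j) (of_real t) = of_real (\<mu> * real n * y)"
    using mu_tail_single[OF n, of "\<lambda>j. \<mu> * real j * a j" \<mu> "of_real t"]
    by (simp add: a_def pw y_def del: of_real_diff)
  then have deriv: "mu_deriv \<mu> F (of_real t) = of_real (1 - \<mu> * real n * y)"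
    using mu_deriv_eq_mu_tail[OF a, of \<mu> "of_real t" F] Fa \<mu> t by simp
  have "1 - y = (\<mu> * real n - 1) / (\<mu> * real n - \<psi>)"
    and "1 - \<mu> * real n * y = \<psi> * (1 - y)"
    unfolding y using \<mu>n \<psi> by (simp_all add: divide_simps) (simp add: algebra_simps)
  moreover from this(1) have "1 - y \<noteq> 0" using \<mu>n \<psi> by simp
  ultimately have "t * (1 - \<mu> * real n * y) / (t * (1 - y)) = \<psi>" using t by simp
  then have "of_real t * mu_deriv \<mu> F (of_real t) / mu_series \<mu> F (of_real t) = of_real \<psi>"
    unfolding series deriv by (metis of_real_divide of_real_mult)
  then show ?thesis
    unfolding starlike_of_order_def using t by (auto intro!: exI[of _ "of_real t"])
qed

lemma monomial_not_close_to_convex: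
  assumes \<mu>: "1 \<le> \<mu>" and n: "n \<ge> 2"
    and F: "F = (\<lambda>j. if j = n then - of_real x else 0)"
    and t: "0 < t" "t < \<rho>" "\<rho> \<le> 1"
    and eq: "\<mu> * real n * (x * t powr (\<mu> * real n - 1)) = 1 - \<psi>"
  shows "\<not> close_to_convex_of_order \<mu> F \<psi> \<rho>"
proof -
  define a where "a = (\<lambda>j. if j = n then x else 0)"
  have a: "1 \<le> conv_radius a" unfolding a_def by (rule conv_radius_single)
  have Fa: "F j = - of_real (a j)" for j by (simp add: F a_def)
  have pw: "complex_of_real t powr of_real (\<mu> * real n - 1) = of_real (t powr (\<mu> * real n - 1))"
    using t by (subst powr_of_real) auto
  have "mu_tail \<mu> (\<lambda>j. \<mu> * real j * a j) (of_real t)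
      = of_real (\<mu> * real n * (x * t powr (\<mu> * real n - 1)))"
    using mu_tail_single[OF n, of "\<lambda>j. \<mu> * real j * a j" \<mu> "of_real t"]
    by (simp add: a_def pw del: of_real_diff)
  then have "mu_deriv \<mu> F (of_real t) = of_real \<psi>"
    using mu_deriv_eq_mu_tail[OF a, of \<mu> "of_real t" F] Fa \<mu> t by (simp only: eq) simp
  then show ?thesis
    unfolding close_to_convex_of_order_def using t by (auto intro!: exI[of _ "of_real t"])
qed

theorem theorem5:
  fixes \<mu> \<gamma> A B \<psi> r1 r2 r3 :: real
    and k m :: nat
    and \<theta> lam \<Xi> :: "nat \<Rightarrow> real"
    and \<Phi> \<Psi> :: "nat \<Rightarrow> complex"
    and Fext :: "nat \<Rightarrow> nat \<Rightarrow> complex"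
  assumes "\<mu> \<ge> 1"
    and "0 \<le> \<gamma>" "\<gamma> < 1"
    and "-1 \<le> B" "B < A" "A \<le> 1" "B < 0"
    and "m \<le> k"
    and "\<Phi> = (\<lambda>n. of_real (\<theta> n))" "\<Phi> \<in> class_A \<mu>"
    and "\<Psi> = (\<lambda>n. of_real (lam n))" "\<Psi> \<in> class_A \<mu>"
    and "\<And>n. n \<ge> 2 \<Longrightarrow> \<theta> n \<ge> 0 \<and> lam n \<ge> 0 \<and> \<theta> n \<ge> lam n"
    and "\<Xi> = (\<lambda>n. (1 - B) * ((\<mu> * real n) ^ k * \<theta> n - (\<mu> * real n) ^ m * lam n)
                   + (A - B) * (1 - \<gamma>) * (\<mu> * real n) ^ m * lam n)"
    and "0 \<le> \<psi>" "\<psi> < 1"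
    and "r1 = (INF n\<in>{2..}. (\<Xi> n / ((A - B) * (1 - \<gamma>))
                 * ((1 - \<psi>) / (\<mu> * real n - \<psi>))) powr (1 / (\<mu> * real n - 1)))"
    and "r2 = (INF n\<in>{2..}. (\<Xi> n / ((A - B) * (1 - \<gamma>))
                 * ((1 - \<psi>) / (\<mu> * real n * (\<mu> * real n - \<psi>)))) powr (1 / (\<mu> * real n - 1)))"
    and "r3 = (INF n\<in>{2..}. (\<Xi> n / ((A - B) * (1 - \<gamma>))
                 * ((1 - \<psi>) / (\<mu> * real n))) powr (1 / (\<mu> * real n - 1)))"
    and "Fext = (\<lambda>n j. if j = n then - of_real ((A - B) * (1 - \<gamma>) / \<Xi> n) else 0)"
  shows "(\<forall>F \<in> class_E_tilde k m \<Phi> \<Psi> A B \<mu> \<gamma>.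
            starlike_of_order \<mu> F \<psi> r1 \<and>
            convex_of_order \<mu> F \<psi> r2 \<and>
            close_to_convex_of_order \<mu> F \<psi> r3)
       \<and> ((\<forall>n\<ge>2. \<Xi> n > 0) \<longrightarrow>
            (\<forall>\<rho>. r1 < \<rho> \<and> \<rho> \<le> 1 \<longrightarrow>
               (\<exists>n\<ge>2. Fext n \<in> class_E_tilde k m \<Phi> \<Psi> A B \<mu> \<gamma> \<and>
                       \<not> starlike_of_order \<mu> (Fext n) \<psi> \<rho>)) \<and>
            (\<forall>\<rho>. r2 < \<rho> \<and> \<rho> \<le> 1 \<longrightarrow>
               (\<exists>n\<ge>2. Fext n \<in> class_E_tilde k m \<Phi> \<Psi> A B \<mu> \<gamma> \<and>
                       \<not> convex_of_order \<mu> (Fext n) \<psi> \<rho>)) \<and>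
            (\<forall>\<rho>. r3 < \<rho> \<and> \<rho> \<le> 1 \<longrightarrow>
               (\<exists>n\<ge>2. Fext n \<in> class_E_tilde k m \<Phi> \<Psi> A B \<mu> \<gamma> \<and>
                       \<not> close_to_convex_of_order \<mu> (Fext n) \<psi> \<rho>)))"
proof -
  note \<mu> = assms(1) and B = assms(4,7) and km = assms(8) and ord = assms(13) and \<Xi> = assms(14)
    and \<psi> = assms(15,16)
  define C where "C = (A - B) * (1 - \<gamma>)"
  have C: "0 < C" using assms(3,5) by (simp add: C_def)
  have \<theta>: "1 \<le> conv_radius \<theta>" and lam: "1 \<le> conv_radius lam"
    using assms(10,12) class_A_iff_conv_radius[OF \<mu>] by (simp_all add: assms(9,11) conv_radius_of_real)
  define q1 where "q1 = (\<lambda>n. (1 - \<psi>) / (\<mu> * real n - \<psi>))"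
  define q2 where "q2 = (\<lambda>n. (1 - \<psi>) / (\<mu> * real n * (\<mu> * real n - \<psi>)))"
  define q3 where "q3 = (\<lambda>n. (1 - \<psi>) / (\<mu> * real n))"
  have r1: "r1 = (INF n\<in>{2..}. (\<Xi> n / C * q1 n) powr (1 / (\<mu> * real n - 1)))"
    and r2: "r2 = (INF n\<in>{2..}. (\<Xi> n / C * q2 n) powr (1 / (\<mu> * real n - 1)))"
    and r3: "r3 = (INF n\<in>{2..}. (\<Xi> n / C * q3 n) powr (1 / (\<mu> * real n - 1)))"
    unfolding q1_def q2_def q3_def C_def by (fact assms(17) assms(18) assms(19))+
  note \<mu>n = mu_index_ge_2[OF \<mu>]
  have q: "0 < q1 n" "0 < q2 n" "0 < q3 n" if "n \<ge> 2" for n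
    using \<mu>n[OF that] \<psi> by (simp_all add: q1_def q2_def q3_def)
  have w: "(\<mu> * real n - \<psi>) * q1 n = 1 - \<psi>" "\<mu> * real n * (\<mu> * real n - \<psi>) * q2 n = 1 - \<psi>"
    "\<mu> * real n * q3 n = 1 - \<psi>" if "n \<ge> 2" for n
    using \<mu>n[OF that] \<psi> that by (auto simp: q1_def q2_def q3_def)
  have \<Xi>_nonneg: "0 \<le> \<Xi> n" if n: "n \<ge> 2" for n
  proof -
    have "(\<mu> * real n) ^ m \<le> (\<mu> * real n) ^ k" using \<mu>n[OF n] km by (intro power_increasing) auto
    then have "(\<mu> * real n) ^ m * lam n \<le> (\<mu> * real n) ^ k * \<theta> n"
      using ord[OF n] \<mu>n[OF n] by (intro mult_mono) auto
    then show ?thesis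
      unfolding \<Xi> C_def[symmetric] using C B ord[OF n] \<mu>n[OF n] by simp
  qed

  have "starlike_of_order \<mu> F \<psi> r1 \<and> convex_of_order \<mu> F \<psi> r2 \<and> close_to_convex_of_order \<mu> F \<psi> r3"
    if F: "F \<in> class_E_tilde k m \<Phi> \<Psi> A B \<mu> \<gamma>" for F
  proof -
    define a where "a = (\<lambda>n. norm (F n))"
    have FX: "F \<in> class_X \<mu>" "F \<in> class_A \<mu>" using F by (auto simp: class_E_tilde_def class_X_def)
    have Fa: "F n = - of_real (a n)" if "n \<ge> 2" for n
      using class_X_coeff[OF FX(1) that] by (simp add: a_def)
    have a: "1 \<le> conv_radius a" using FX(2) class_A_iff_conv_radius[OF \<mu>] by (simp add: a_def)
    have a0: "0 \<le> a n" for n by (simp add: a_def)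
    note bound = class_E_tilde_coeff_bound[OF \<mu> C[unfolded C_def] B km \<theta> lam _ \<Xi>
        F[unfolded assms(9,11)], folded C_def]
    have sm: "summable (\<lambda>n. \<Xi> (n + 2) / C * a (n + 2))"
      and le: "(\<Sum>n. \<Xi> (n + 2) / C * a (n + 2)) \<le> 1"
      using summable_divide[OF bound(1), of C] suminf_divide[OF bound(1), of C] bound(2) ord C
      by (simp_all add: a_def)
    have lt: "mu_sum \<mu> (\<lambda>n. w n * a n) s < 1 - \<psi>"
      if "r = (INF n\<in>{2..}. (\<Xi> n / C * p n) powr (1 / (\<mu> * real n - 1)))" "0 < s" "s < r"
        "\<And>n. n \<ge> 2 \<Longrightarrow> 0 < p n \<and> w n * p n = 1 - \<psi>" for r s w p
    proof (rule weighted_sum_lt_inside_radius[OF \<mu> _ _ sm le that(1-3)])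
      fix n :: nat assume n: "n \<ge> 2"
      have "0 < w n * p n" using that(4)[OF n] \<psi> by simp
      then have "0 < w n" using that(4)[OF n] zero_less_mult_pos2 by blast
      moreover have "w n * (\<Xi> n / C * p n) = (w n * p n) * (\<Xi> n / C)" by simp
      ultimately show "0 \<le> a n \<and> 0 \<le> \<Xi> n / C \<and> 0 \<le> \<Xi> n / C * p n \<and> 0 < w n
          \<and> w n * (\<Xi> n / C * p n) = (1 - \<psi>) * (\<Xi> n / C)"
        using that(4)[OF n] a0 \<Xi>_nonneg[OF n] C by simp
    qed (use \<psi> in simp)
    have "starlike_of_order \<mu> F \<psi> r1"
      by (rule starlike_if_weighted_sum[OF \<mu> \<psi>(2) Fa a a0]) (auto intro!: lt[OF r1] simp: q w)
    moreover have "starlike_of_order \<mu> (mu_D \<mu> 1 F) \<psi> r2"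
    proof (rule starlike_if_weighted_sum[OF \<mu> \<psi>(2)])
      show "mu_D \<mu> 1 F n = - of_real (\<mu> * real n * a n)" if "n \<ge> 2" for n
        using Fa[OF that] by (simp add: mu_D_def)
      show "1 \<le> conv_radius (\<lambda>n. \<mu> * real n * a n)"
        using conv_radius_ge_1_mult[OF conv_radius_ge_1_linear_weight[of \<mu> 0] a] by simp
      fix s assume s: "0 < s" "s < r2"
      then show "mu_sum \<mu> (\<lambda>n. (\<mu> * real n - \<psi>) * (\<mu> * real n * a n)) s < 1 - \<psi>"
        using lt[OF r2 s, of "\<lambda>n. \<mu> * real n * (\<mu> * real n - \<psi>)"] q w by (simp add: mult_ac)
    qed (use \<mu> a0 in auto)
    then have "convex_of_order \<mu> F \<psi> r2" using convex_iff_starlike[OF \<mu> Fa a] by simp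
    moreover have "close_to_convex_of_order \<mu> F \<psi> r3"
      by (rule close_to_convex_if_weighted_sum[OF \<mu> Fa a a0]) (auto intro!: lt[OF r3] simp: q w)
    ultimately show ?thesis by blast
  qed
  moreover have "(\<forall>\<rho>. r1 < \<rho> \<and> \<rho> \<le> 1 \<longrightarrow>
               (\<exists>n\<ge>2. Fext n \<in> class_E_tilde k m \<Phi> \<Psi> A B \<mu> \<gamma> \<and>
                       \<not> starlike_of_order \<mu> (Fext n) \<psi> \<rho>)) \<and>
            (\<forall>\<rho>. r2 < \<rho> \<and> \<rho> \<le> 1 \<longrightarrow>
               (\<exists>n\<ge>2. Fext n \<in> class_E_tilde k m \<Phi> \<Psi> A B \<mu> \<gamma> \<and>
                       \<not> convex_of_order \<mu> (Fext n) \<psi> \<rho>)) \<and>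
            (\<forall>\<rho>. r3 < \<rho> \<and> \<rho> \<le> 1 \<longrightarrow>
               (\<exists>n\<ge>2. Fext n \<in> class_E_tilde k m \<Phi> \<Psi> A B \<mu> \<gamma> \<and>
                       \<not> close_to_convex_of_order \<mu> (Fext n) \<psi> \<rho>))"
    if pos: "\<forall>n\<ge>2. \<Xi> n > 0"
  proof -
    have mem: "Fext n \<in> class_E_tilde k m \<Phi> \<Psi> A B \<mu> \<gamma>" if n: "n \<ge> 2" for n
      unfolding assms(9,11)
      by (rule extremal_in_class_E_tilde[OF \<mu> C[unfolded C_def] B(2) km \<theta> lam n, of "\<Xi> n"])
         (use ord[OF n] pos n in \<open>auto simp: assms(20) \<Xi>\<close>)
    have Fext: "Fext n = (\<lambda>j. if j = n then - of_real (C / \<Xi> n) else 0)" for n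
      unfolding assms(20) C_def by (rule refl)
    \<comment> \<open>A radius below \<open>\<rho>\<close> yields an extremal function and a point where its weighted term is \<open>1 - \<psi>\<close>.\<close>
    have witness: "\<exists>n t. n \<ge> 2 \<and> 0 < t \<and> t < \<rho> \<and> w n * (C / \<Xi> n * t powr (\<mu> * real n - 1)) = 1 - \<psi>"
      if "(INF n\<in>{2..}. (\<Xi> n / C * p n) powr (1 / (\<mu> * real n - 1))) < \<rho>"
        "\<And>n. n \<ge> 2 \<Longrightarrow> 0 < p n \<and> w n * p n = 1 - \<psi>" for \<rho> w p
    proof -
      have "0 < \<Xi> n / C * p n" if "n \<ge> 2" for n using pos C \<open>\<And>n. n \<ge> 2 \<Longrightarrow> 0 < p n \<and> _ n\<close> that by simp
      from radius_exceeded[OF \<mu> this that(1)] obtain n t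
        where nt: "n \<ge> 2" "0 < t" "t < \<rho>" "t powr (\<mu> * real n - 1) = \<Xi> n / C * p n" by blast
      have "\<Xi> n \<noteq> 0" using pos nt(1) by fastforce
      then have "C / \<Xi> n * t powr (\<mu> * real n - 1) = p n" unfolding nt(4) using C by simp
      then have "w n * (C / \<Xi> n * t powr (\<mu> * real n - 1)) = 1 - \<psi>"
        using that(2)[OF nt(1)] by (simp only:)
      with nt(1-3) show ?thesis by blast
    qed
    have "\<exists>n\<ge>2. Fext n \<in> class_E_tilde k m \<Phi> \<Psi> A B \<mu> \<gamma> \<and> \<not> starlike_of_order \<mu> (Fext n) \<psi> \<rho>"
      if \<rho>: "r1 < \<rho>" "\<rho> \<le> 1" for \<rho>
    proof -
      obtain n t where nt: "n \<ge> 2" "0 < t" "t < \<rho>"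
        "(\<mu> * real n - \<psi>) * (C / \<Xi> n * t powr (\<mu> * real n - 1)) = 1 - \<psi>"
        using witness[OF \<rho>(1)[unfolded r1], of "\<lambda>n. \<mu> * real n - \<psi>"] q w by blast
      then show ?thesis using mem monomial_not_starlike[OF \<mu> \<psi> nt(1) Fext nt(2,3) \<rho>(2) nt(4)] by blast
    qed
    moreover have "\<exists>n\<ge>2. Fext n \<in> class_E_tilde k m \<Phi> \<Psi> A B \<mu> \<gamma> \<and> \<not> convex_of_order \<mu> (Fext n) \<psi> \<rho>"
      if \<rho>: "r2 < \<rho>" "\<rho> \<le> 1" for \<rho>
    proof -
      obtain n t where nt: "n \<ge> 2" "0 < t" "t < \<rho>"
        "\<mu> * real n * (\<mu> * real n - \<psi>) * (C / \<Xi> n * t powr (\<mu> * real n - 1)) = 1 - \<psi>"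
        using witness[OF \<rho>(1)[unfolded r2], of "\<lambda>n. \<mu> * real n * (\<mu> * real n - \<psi>)"] q w by blast
      have "mu_D \<mu> 1 (Fext n) = (\<lambda>j. if j = n then - of_real (\<mu> * real n * (C / \<Xi> n)) else 0)"
        by (auto simp: mu_D_def Fext)
      then have "\<not> starlike_of_order \<mu> (mu_D \<mu> 1 (Fext n)) \<psi> \<rho>"
        by (rule monomial_not_starlike[OF \<mu> \<psi> nt(1) _ nt(2,3) \<rho>(2)]) (use nt(4) in \<open>simp add: mult_ac\<close>)
      moreover have "convex_of_order \<mu> (Fext n) \<psi> \<rho> \<longleftrightarrow> starlike_of_order \<mu> (mu_D \<mu> 1 (Fext n)) \<psi> \<rho>"
        by (rule convex_iff_starlike[OF \<mu> _ conv_radius_single[of n "C / \<Xi> n"]]) (simp add: Fext)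
      ultimately show ?thesis using mem nt(1) by blast
    qed
    moreover have "\<exists>n\<ge>2. Fext n \<in> class_E_tilde k m \<Phi> \<Psi> A B \<mu> \<gamma> \<and> \<not> close_to_convex_of_order \<mu> (Fext n) \<psi> \<rho>"
      if \<rho>: "r3 < \<rho>" "\<rho> \<le> 1" for \<rho>
    proof -
      obtain n t where nt: "n \<ge> 2" "0 < t" "t < \<rho>" "\<mu> * real n * (C / \<Xi> n * t powr (\<mu> * real n - 1)) = 1 - \<psi>"
        using witness[OF \<rho>(1)[unfolded r3], of "\<lambda>n. \<mu> * real n"] q w by blast
      then show ?thesis
        using mem monomial_not_close_to_convex[OF \<mu> nt(1) Fext nt(2,3) \<rho>(2) nt(4)] by blast
    qed
    ultimately show ?thesis by blast
  qed
  ultimately show ?thesis by blast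
qed

end
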